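(* (i) If $A\in M_{n\times n}(\mathbb{R})$ is a nonnegative matrix, then $$\overline{\lambda}_{S_+}(A)\geq \max\{|\lambda_j(A)|,\ j=1,\ldots,n\}>0;$$ moreover, if in addition $\overline{\lambda}_{S_+}(A)$ is an eigenvalue of $A$, then $$\overline{\lambda}_{S_+}(A)= \max\{|\lambda_j(A)|,\ j=1,\ldots,n\}>0.$$ (ii) If $A\in M_{n\times n}(\mathbb{R})$ is a matrix with nonnegative elements off the diagonal, then $$\overline{\lambda}_{S_+}(A)\geq\max\{\operatorname{Re}\lambda_j(A),\ j=1,\ldots,n\};$$ moreover, if in addition $\overline{\lambda}_{S_+}(A)$ is the real part of an eigenvalue of $A$, then $$\overline{\lambda}_{S_+}(A)=\max\{\operatorname{Re}\lambda_j(A),\ j=1,\ldots,n\}.$$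
   Context: $M_{n\times n}(\mathbb{R})$ is the space of real $n\times n$ matrices; $\lambda_j(A)\in\mathbb{C}$, $j=1,\dots,n$, are the eigenvalues of $A$ repeated according to multiplicity; $\langle\cdot,\cdot\rangle$ is the standard inner product on $\mathbb{R}^n$. $S_+^o=\{u\in\mathbb{R}^n\mid u_i>0,\ i=1,\dots,n\}$, $S_+=\overline{S_+^o}\setminus\{0\}$. The upper quasi-eigenvalue of $A$ in $S_+$ is $\overline{\lambda}_{S_+}(A):=\sup_{u\in S_+}\inf_{v\in S_+^o}\frac{\langle Au,v\rangle}{\langle u,v\rangle}$.
   Formalization: In (i) the strict positivity "> 0" (both occurrences) is asserted only when A is not nilpotent; it fails for nilpotent nonnegative matrices such as A = 0, whose eigenvalues are all 0. The inequality and the equality are stated for all nonnegative A. *)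

theory Defs
  imports "HOL-Analysis.Analysis" "HOL-Computational_Algebra.Fundamental_Theorem_Algebra"
begin

definition S_plus_o :: "(real ^ 'n) set" where
  "S_plus_o = {u. \<forall>i. 0 < u $ i}"

definition S_plus :: "(real ^ 'n) set" where
  "S_plus = closure S_plus_o - {0}"

text \<open>
  The infimum and the supremum are taken in the extended reals: for a general matrix
  the inner infimum can be \<open>-\<infinity>\<close> (when \<open>(A *v u) $ i < 0\<close> at an index with \<open>u $ i = 0\<close>).
  The denominator is always positive on \<^const>\<open>S_plus\<close> and \<^const>\<open>S_plus_o\<close>.
\<close>

definition upper_quasi_eigenvalue :: "real ^ 'n ^ 'n \<Rightarrow> ereal" where
  "upper_quasi_eigenvalue A =
     (SUP u\<in>S_plus. INF v\<in>S_plus_o. ereal (((A *v u) \<bullet> v) / (u \<bullet> v)))"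

definition is_eigenvalue :: "real ^ 'n ^ 'n \<Rightarrow> complex \<Rightarrow> bool" where
  "is_eigenvalue A z \<longleftrightarrow> (\<exists>x. x \<noteq> 0 \<and> map_matrix complex_of_real A *v x = z *s x)"

definition charpoly :: "'a::comm_ring_1 ^ 'n ^ 'n \<Rightarrow> 'a poly" where
  "charpoly M = det (mat [:0, 1:] - map_matrix (\<lambda>c. [:c:]) M)"

text \<open>
  The complex eigenvalues of a real matrix, each with its algebraic multiplicity.
  The lemmas below confirm that there are \<open>CARD('n)\<close> of them and that their elements
  are exactly the eigenvalues in the sense of \<^const>\<open>is_eigenvalue\<close>.
\<close>

definition eigenvalues_mset :: "real ^ 'n ^ 'n \<Rightarrow> complex multiset" where
  "eigenvalues_mset A = proots (charpoly (map_matrix complex_of_real A))"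

text \<open>
  A nilpotent nonnegative matrix (such as 0) has only the eigenvalue 0, so strict positivity
  of the largest modulus of an eigenvalue can only be claimed when this predicate fails.
  Powers are taken with respect to the matrix product; the type class operations on
  \<^typ>\<open>real ^ 'n ^ 'n\<close> are componentwise.
\<close>

definition nilpotent_matrix :: "real ^ 'n ^ 'n \<Rightarrow> bool" where
  "nilpotent_matrix A \<longleftrightarrow> (\<exists>k. (((**) A) ^^ k) (mat 1) = 0)"

lemma S_plus_pos_denominator:
  assumes "u \<in> S_plus" "v \<in> S_plus_o"
  shows "0 < u \<bullet> v"
proof -
  have "S_plus_o \<subseteq> {w :: real ^ 'a. \<forall>i. 0 \<le> w $ i}"
    by (auto simp: S_plus_o_def less_imp_le)
  moreover have "closed {w :: real ^ 'a. \<forall>i. 0 \<le> w $ i}"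
    by (intro closed_Collect_all closed_Collect_le continuous_intros)
  ultimately have "closure S_plus_o \<subseteq> {w :: real ^ 'a. \<forall>i. 0 \<le> w $ i}"
    by (rule closure_minimal)
  with assms have u: "0 \<le> u $ i" "u \<noteq> 0" for i
    by (auto simp: S_plus_def)
  then obtain k where "u $ k \<noteq> 0"
    by (auto simp: vec_eq_iff)
  with u(1)[of k] have k: "0 < u $ k"
    by linarith
  have "u \<bullet> v = (\<Sum>i\<in>UNIV. u $ i * v $ i)"
    by (simp add: inner_vec_def)
  also have "\<dots> > 0"
    using assms(2) u(1) k
    by (intro sum_pos2[of _ k]) (auto simp: S_plus_o_def less_imp_le)
  finally show ?thesis .
qed

lemma degree_charpoly_and_lead_coeff:
  fixes M :: "complex ^ 'n ^ 'n"
  shows "degree (charpoly M) = CARD('n)" "coeff (charpoly M) CARD('n) = 1"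
proof -
  define B where "B = mat [:0, 1:] - map_matrix (\<lambda>c. [:c:]) M"
  define t where "t p = of_int (sign p) * (\<Prod>i\<in>UNIV. B $ i $ p i)" for p :: "'n \<Rightarrow> 'n"
  have B: "B $ i $ j = (if i = j then [:- (M $ i $ i), 1:] else [:- (M $ i $ j):])" for i j
    by (simp add: B_def mat_def)
  have deg_t: "degree (t p) < CARD('n)" if p: "p \<noteq> id" for p
  proof -
    obtain k where k: "p k \<noteq> k" using p by (auto simp: fun_eq_iff)
    have "degree (t p) \<le> degree (\<Prod>i\<in>UNIV. B $ i $ p i)"
      by (auto simp: t_def sign_def)
    also have "\<dots> \<le> (\<Sum>i\<in>UNIV. degree (B $ i $ p i))"
      using degree_prod_sum_le[of UNIV "\<lambda>i. B $ i $ p i"] by (simp add: o_def)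
    also have "\<dots> < (\<Sum>i\<in>(UNIV::'n set). 1)"
      by (rule sum_strict_mono_ex1) (use k in \<open>auto simp: B intro!: exI[of _ k]\<close>)
    finally show ?thesis by simp
  qed
  have tid: "t id = (\<Prod>i\<in>UNIV. [:- (M $ i $ i), 1:])"
    by (simp add: t_def B)
  have d1: "degree (t id) = CARD('n)"
    unfolding tid by (subst degree_prod_sum_eq) auto
  have l1: "coeff (t id) CARD('n) = 1"
    using d1 lead_coeff_prod[of "\<lambda>i. [:- (M $ i $ i), 1:]" "UNIV :: 'n set"]
    by (simp add: tid)
  have "charpoly M = (\<Sum>p | p permutes (UNIV :: 'n set). t p)"
    by (simp add: charpoly_def det_def t_def B_def)
  also have "\<dots> = t id + (\<Sum>p\<in>{p. p permutes (UNIV :: 'n set)} - {id}. t p)"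
    by (rule sum.remove) (auto simp: permutes_id)
  finally have eq: "charpoly M = t id + (\<Sum>p\<in>{p. p permutes (UNIV :: 'n set)} - {id}. t p)" .
  have "degree (\<Sum>p\<in>{p. p permutes (UNIV :: 'n set)} - {id}. t p) < CARD('n)"
    by (rule degree_sum_less) (use deg_t in auto)
  then show "degree (charpoly M) = CARD('n)" "coeff (charpoly M) CARD('n) = 1"
    using d1 l1 by (auto simp: eq degree_add_eq_left coeff_eq_0)
qed

lemma size_eigenvalues_mset: "size (eigenvalues_mset (A :: real ^ 'n ^ 'n)) = CARD('n)"
  by (simp add: eigenvalues_mset_def size_proots_complex degree_charpoly_and_lead_coeff)

lemma poly_charpoly: "poly (charpoly M) z = det (mat z - M)"
proof -
  have *: "poly (of_int (sign p)) z = of_int (sign p)" for p :: "'b \<Rightarrow> 'b"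
    by (simp add: sign_def)
  show ?thesis
    by (auto simp: charpoly_def det_def poly_sum poly_prod * mat_def intro!: sum.cong prod.cong
        arg_cong2[where f = "(*)"])
qed

lemma set_eigenvalues_mset: "set_mset (eigenvalues_mset A) = {z. is_eigenvalue A z}"
proof -
  define M where "M = map_matrix complex_of_real A"
  have "charpoly M \<noteq> 0"
    using degree_charpoly_and_lead_coeff(2)[of M] by auto
  then have "set_mset (eigenvalues_mset A) = {z. det (mat z - M) = 0}"
    by (simp add: eigenvalues_mset_def M_def poly_charpoly)
  also have "\<dots> = {z. is_eigenvalue A z}"
  proof -
    have "mat z *v x = z *s x" for z :: complex and x :: "complex ^ 'a"
      by (simp add: vec_eq_iff matrix_vector_mult_def mat_def if_distrib[of "\<lambda>y. y * _"] cong: if_cong)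
    then have "(mat z - M) *v x = 0 \<longleftrightarrow> M *v x = z *s x" for z x
      by (auto simp: matrix_vector_mult_diff_rdistrib)
    then have "det (mat z - M) = 0 \<longleftrightarrow> is_eigenvalue A z" for z
      using invertible_det_nz[of "mat z - M"] invertible_left_inverse[of "mat z - M"]
        matrix_left_invertible_ker[of "mat z - M"]
      by (auto simp: is_eigenvalue_def M_def)
    then show ?thesis by simp
  qed
  finally show ?thesis .
qed

end

theory Submission
  imports Defs
begin

text \<open>
  If \<open>A x = z x\<close>, the triangle inequality gives \<open>r \<bar>x\<bar> \<le> A \<bar>x\<bar>\<close> entrywise, with
  \<open>r = \<bar>z\<bar>\<close> for nonnegative \<open>A\<close> and \<open>r = Re z\<close> if only the off-diagonal entries are nonnegative
  (isolate the diagonal term); testing the supremum with \<open>u = \<bar>x\<bar>\<close> yields both lower bounds.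
  For the strict positivity, every vector is annihilated by some nonzero polynomial in \<open>A\<close>; if no
  eigenvalue is nonzero, all factors of that polynomial except powers of \<open>A\<close> can be cancelled,
  so \<open>A\<close> is nilpotent.
\<close>

section \<open>Lower bounds for the quasi-eigenvalue\<close>

lemma S_plus_iff: "u \<in> S_plus \<longleftrightarrow> (\<forall>i. 0 \<le> u $ i) \<and> u \<noteq> 0"
proof -
  have "closure S_plus_o = {w :: real ^ 'a. \<forall>i. 0 \<le> w $ i}"
  proof
    show "closure S_plus_o \<subseteq> {w :: real ^ 'a. \<forall>i. 0 \<le> w $ i}"
      by (rule closure_minimal)
        (auto simp: S_plus_o_def less_imp_le
          intro!: closed_Collect_all closed_Collect_le continuous_intros)
    show "{w :: real ^ 'a. \<forall>i. 0 \<le> w $ i} \<subseteq> closure S_plus_o"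
    proof
      fix w :: "real ^ 'a"
      assume "w \<in> {w. \<forall>i. 0 \<le> w $ i}"
      then have w: "0 \<le> w $ i" for i
        by simp
      \<comment> \<open>Here \<open>1\<close> is the all-ones vector, so each shift makes every
        entry of the nonnegative \<open>w\<close> positive.\<close>
      have "(\<lambda>n. w + (1 / real (Suc n)) *\<^sub>R 1) \<longlonglongrightarrow> w + 0 *\<^sub>R 1"
        by (intro tendsto_intros LIMSEQ_Suc lim_1_over_n)
      moreover have "w + (1 / real (Suc n)) *\<^sub>R 1 \<in> S_plus_o" for n
        using w by (auto simp: S_plus_o_def intro!: add_nonneg_pos)
      ultimately show "w \<in> closure S_plus_o"
        by (auto simp: closure_sequential intro!: exI[of _ "\<lambda>n. w + (1 / real (Suc n)) *\<^sub>R 1"])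
    qed
  qed
  then show ?thesis
    by (auto simp: S_plus_def)
qed

text \<open>Pairing the entrywise inequality with a positive \<open>v\<close> preserves it, so at
  this \<open>u\<close> every quotient is at least \<open>r\<close>; a single such \<open>u\<close>
  bounds the supremum from below.\<close>

lemma upper_quasi_eigenvalue_ge:
  assumes u: "u \<in> S_plus" and le: "\<And>i. r * u $ i \<le> (A *v u) $ i"
  shows "ereal r \<le> upper_quasi_eigenvalue A"
proof -
  have "r \<le> ((A *v u) \<bullet> v) / (u \<bullet> v)" if v: "v \<in> S_plus_o" for v
  proof -
    have "r * (u \<bullet> v) = (\<Sum>i\<in>UNIV. r * u $ i * v $ i)"
      by (simp add: inner_vec_def sum_distrib_left mult.assoc)
    also have "\<dots> \<le> (\<Sum>i\<in>UNIV. (A *v u) $ i * v $ i)"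
      using v le by (intro sum_mono mult_right_mono) (auto simp: S_plus_o_def less_imp_le)
    also have "\<dots> = (A *v u) \<bullet> v"
      by (simp add: inner_vec_def)
    finally show ?thesis
      using S_plus_pos_denominator[OF u v] by (simp add: pos_le_divide_eq)
  qed
  then show ?thesis
    unfolding upper_quasi_eigenvalue_def
    by (intro SUP_upper2[OF u] INF_greatest) simp
qed

lemma upper_quasi_eigenvalue_ge_cmod:
  assumes nonneg: "\<And>i j. 0 \<le> A $ i $ j" and "is_eigenvalue A z"
  shows "ereal (cmod z) \<le> upper_quasi_eigenvalue A"
proof -
  obtain x where x: "x \<noteq> 0" and eq: "map_matrix complex_of_real A *v x = z *s x"
    using assms(2) by (auto simp: is_eigenvalue_def)
  define u :: "real ^ 'a" where "u = (\<chi> i. cmod (x $ i))"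
  have "u \<in> S_plus"
    using x by (auto simp: S_plus_iff u_def vec_eq_iff)
  moreover have "cmod z * u $ i \<le> (A *v u) $ i" for i
  proof -
    have "z * x $ i = (\<Sum>j\<in>UNIV. complex_of_real (A $ i $ j) * x $ j)"
      using arg_cong[OF eq, of "\<lambda>y. y $ i"] by (simp add: matrix_vector_mult_def)
    then have "cmod z * u $ i = cmod (\<Sum>j\<in>UNIV. complex_of_real (A $ i $ j) * x $ j)"
      by (metis norm_mult u_def vec_lambda_beta)
    also have "\<dots> \<le> (\<Sum>j\<in>UNIV. A $ i $ j * u $ j)"
      using nonneg by (intro sum_norm_le) (simp add: norm_mult u_def)
    finally show ?thesis
      by (simp add: matrix_vector_mult_def)
  qed
  ultimately show ?thesis
    by (rule upper_quasi_eigenvalue_ge)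
qed

lemma upper_quasi_eigenvalue_ge_Re:
  assumes nonneg: "\<And>i j. i \<noteq> j \<Longrightarrow> 0 \<le> A $ i $ j" and "is_eigenvalue A z"
  shows "ereal (Re z) \<le> upper_quasi_eigenvalue A"
proof -
  obtain x where x: "x \<noteq> 0" and eq: "map_matrix complex_of_real A *v x = z *s x"
    using assms(2) by (auto simp: is_eigenvalue_def)
  define u :: "real ^ 'a" where "u = (\<chi> i. cmod (x $ i))"
  have "u \<in> S_plus"
    using x by (auto simp: S_plus_iff u_def vec_eq_iff)
  moreover have "Re z * u $ i \<le> (A *v u) $ i" for i
  proof -
    have "z * x $ i = (\<Sum>j\<in>UNIV. complex_of_real (A $ i $ j) * x $ j)"
      using arg_cong[OF eq, of "\<lambda>y. y $ i"] by (simp add: matrix_vector_mult_def)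
    \<comment> \<open>The entry \<open>A $ i $ i\<close> may be negative, so it is moved to the left
      before moduli are taken; being real, it lowers \<open>Re z\<close> by exactly its own
      value.\<close>
    then have off_diag: "(z - A $ i $ i) * x $ i
        = (\<Sum>j\<in>UNIV - {i}. complex_of_real (A $ i $ j) * x $ j)"
      by (simp add: sum.remove[of UNIV i] algebra_simps)
    have "(Re z - A $ i $ i) * u $ i \<le> cmod (z - A $ i $ i) * u $ i"
      using complex_Re_le_cmod[of "z - A $ i $ i"] by (intro mult_right_mono) (auto simp: u_def)
    also have "\<dots> = cmod (\<Sum>j\<in>UNIV - {i}. complex_of_real (A $ i $ j) * x $ j)"
      by (simp add: u_def flip: off_diag norm_mult)
    also have "\<dots> \<le> (\<Sum>j\<in>UNIV - {i}. A $ i $ j * u $ j)"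
      using nonneg by (intro sum_norm_le) (auto simp: norm_mult u_def)
    finally show ?thesis
      by (simp add: matrix_vector_mult_def sum.remove[of UNIV i] algebra_simps)
  qed
  ultimately show ?thesis
    by (rule upper_quasi_eigenvalue_ge)
qed

section \<open>Polynomials in a matrix acting on a vector\<close>

definition poly_matrix_vector :: "'a::field ^ 'n ^ 'n \<Rightarrow> 'a poly \<Rightarrow> 'a ^ 'n \<Rightarrow> 'a ^ 'n" where
  "poly_matrix_vector M p w = fold_coeffs (\<lambda>a y. a *s w + M *v y) p 0"

lemma poly_matrix_vector_0 [simp]: "poly_matrix_vector M 0 w = 0"
  by (simp add: poly_matrix_vector_def)

text \<open>Horner's rule for p(M) w. At \<open>pCons 0 0\<close> the fold returns its start value
  0, which agrees with the right-hand side. Acting on vectors avoids evaluating p in the matrix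
  type, whose type class product is componentwise.\<close>

lemma poly_matrix_vector_pCons [simp]:
  "poly_matrix_vector M (pCons a p) w = a *s w + M *v poly_matrix_vector M p w"
  by (cases "pCons a p = 0") (auto simp: poly_matrix_vector_def fold_coeffs_pCons_not_0_0_eq)

lemma poly_matrix_vector_add:
  "poly_matrix_vector M (p + q) w = poly_matrix_vector M p w + poly_matrix_vector M q w"
  by (induction p q rule: poly_induct2)
    (simp_all add: matrix_vector_right_distrib vec.scale_left_distrib algebra_simps)

lemma poly_matrix_vector_smult: "poly_matrix_vector M (smult c p) w = c *s poly_matrix_vector M p w"
  by (induction p)
    (simp_all add: vec.scale_right_distrib vec.scale)

lemma poly_matrix_vector_sum:
  "poly_matrix_vector M (\<Sum>i\<in>I. f i) w = (\<Sum>i\<in>I. poly_matrix_vector M (f i) w)"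
  by (induction I rule: infinite_finite_induct) (simp_all add: poly_matrix_vector_add)

lemma poly_matrix_vector_monom:
  "poly_matrix_vector M (monom c i) w = c *s ((*v) M ^^ i) w"
  by (induction i) (simp_all add: monom_0 monom_Suc vec.scale)

lemma poly_matrix_vector_commute:
  "poly_matrix_vector M p (M *v w) = M *v poly_matrix_vector M p w"
  by (induction p) (simp_all add: matrix_vector_right_distrib vec.scale)

text \<open>If the product annihilates \<open>w\<close>, this becomes the eigenvector equation for
  p(M) w with eigenvalue \<open>z\<close>.\<close>

lemma poly_matrix_vector_linear_mult:
  "poly_matrix_vector M ([:- z, 1:] * p) w
    = M *v poly_matrix_vector M p w - z *s poly_matrix_vector M p w"
  by (simp add: poly_matrix_vector_add poly_matrix_vector_smult flip: smult_minus_left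
      del: smult_minus_left)

text \<open>The vectors w, M w, ..., M^n w with n = \<open>CARD('n)\<close> are one too many to be
  independent; the coefficients of a linear relation form the polynomial.\<close>

lemma exists_annihilating_poly:
  fixes M :: "'a::field ^ 'n ^ 'n"
  obtains p where "p \<noteq> 0" "poly_matrix_vector M p w = 0"
proof -
  define v where "v i = ((*v) M ^^ i) w" for i
  define I where "I = {..CARD('n)}"
  show ?thesis
  proof (cases "inj_on v I")
    \<comment> \<open>Dependence concerns the set of these vectors, where repetitions collapse; a
      repetition gives the polynomial X^i - X^j directly.\<close>
    case False
    then obtain i j where ij: "i \<noteq> j" "v i = v j"
      by (auto simp: inj_on_def)
    define p where "p = monom 1 i + monom (- 1 :: 'a) j"
    have "coeff p i = 1"
      using ij by (simp add: p_def)
    then have "p \<noteq> 0"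
      by auto
    moreover have "poly_matrix_vector M p w = 0"
      using ij by (simp add: p_def poly_matrix_vector_add poly_matrix_vector_monom v_def)
    ultimately show ?thesis
      by (rule that)
  next
    case True
    then have "card (v ` I) = Suc CARD('n)"
      by (simp add: card_image I_def)
    then have "vec.dependent (v ` I)"
      using vec.independent_card_le_dim[of "v ` I" UNIV] by (auto simp: card_cart_basis vec.dim_UNIV)
    then obtain c b where b: "b \<in> v ` I" "c b \<noteq> 0" and "(\<Sum>y\<in>v ` I. c y *s y) = 0"
      by (auto simp: vec.dependent_finite I_def)
    then have sum0: "(\<Sum>i\<in>I. c (v i) *s v i) = 0"
      using True by (simp add: sum.reindex)
    obtain k where k: "k \<in> I" "b = v k"
      using b by auto
    define p where "p = (\<Sum>i\<in>I. monom (c (v i)) i)"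
    have "coeff p k = c b"
      using k by (simp add: p_def coeff_sum I_def)
    with b have "p \<noteq> 0"
      by auto
    moreover have "poly_matrix_vector M p w = 0"
      using sum0 by (simp add: p_def poly_matrix_vector_sum poly_matrix_vector_monom v_def)
    ultimately show ?thesis
      by (rule that)
  qed
qed

text \<open>Induction on the degree of an annihilating polynomial, splitting off a root
  \<open>z\<close>. If \<open>z\<close> is nonzero, the cofactor q must already annihilate
  \<open>w\<close>, since q(M) w would otherwise be a forbidden eigenvector. If \<open>z\<close> is
  zero, q annihilates \<open>M *v w\<close>.\<close>

lemma matrix_power_annihilates_vector:
  fixes M :: "complex ^ 'n ^ 'n"
  assumes no_ev: "\<And>z x. M *v x = z *s x \<Longrightarrow> z \<noteq> 0 \<Longrightarrow> x = 0"
  shows "\<exists>k. ((*v) M ^^ k) w = 0"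
proof -
  \<comment> \<open>The vector is generalized because the root zero replaces \<open>w\<close> by
    \<open>M *v w\<close>.\<close>
  have "\<exists>k. ((*v) M ^^ k) w = 0" if "p \<noteq> 0" "poly_matrix_vector M p w = 0" for p w
    using that
  proof (induction "degree p" arbitrary: p w)
    case 0
    then obtain c where "p = [:c:]" "c \<noteq> 0"
      by (metis degree_eq_zeroE pCons_0_0)
    with 0 have "w = 0"
      by simp
    then show ?case
      by (intro exI[of _ 0]) simp
  next
    case (Suc d)
    then obtain z where "poly p z = 0"
      by (metis constant_degree fundamental_theorem_of_algebra nat.simps(3))
    then obtain q where p: "p = [:- z, 1:] * q"
      by (auto simp: poly_eq_0_iff_dvd elim: dvdE)
    with Suc have q: "q \<noteq> 0" "degree q = d"
      by (auto simp: degree_mult_eq simp del: mult_pCons_left)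
    have eigen: "M *v poly_matrix_vector M q w = z *s poly_matrix_vector M q w"
      using Suc.prems(2) unfolding p poly_matrix_vector_linear_mult by simp
    show ?case
    proof (cases "z = 0")
      case True
      with eigen have "poly_matrix_vector M q (M *v w) = 0"
        by (simp add: poly_matrix_vector_commute)
      with Suc.hyps(1) q obtain k where "((*v) M ^^ k) (M *v w) = 0"
        by metis
      then show ?thesis
        by (intro exI[of _ "Suc k"]) (simp add: funpow_swap1)
    next
      case False
      with no_ev eigen have "poly_matrix_vector M q w = 0"
        by blast
      with Suc.hyps(1) q show ?thesis
        by metis
    qed
  qed
  then show ?thesis
    by (metis exists_annihilating_poly)
qed

text \<open>The vectorwise exponents found over the complex numbers carry over to real vectors;
  finitely many basis vectors then admit a common exponent.\<close>

lemma nilpotent_matrixI: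
  fixes A :: "real ^ 'n ^ 'n"
  assumes no_ev: "\<And>z. is_eigenvalue A z \<Longrightarrow> z = 0"
  shows "nilpotent_matrix A"
proof -
  define M where "M = map_matrix complex_of_real A"
  define cv :: "real ^ 'n \<Rightarrow> complex ^ 'n" where "cv x = (\<chi> i. complex_of_real (x $ i))" for x
  have cv_eq_0: "cv x = 0 \<longleftrightarrow> x = 0" for x
    by (simp add: cv_def vec_eq_iff)
  have M_cv: "M *v cv x = cv (A *v x)" for x
    by (simp add: cv_def M_def matrix_vector_mult_def vec_eq_iff)
  have pow_cv: "((*v) M ^^ k) (cv x) = cv (((*v) A ^^ k) x)" for k x
    by (induction k) (simp_all add: M_cv)
  have "\<exists>k. ((*v) A ^^ k) x = 0" for x
  proof -
    have "y = 0" if "M *v y = z *s y" "z \<noteq> 0" for y z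
      using no_ev that by (auto simp: is_eigenvalue_def M_def)
    then have "\<exists>k. ((*v) M ^^ k) (cv x) = 0"
      by (rule matrix_power_annihilates_vector)
    then show ?thesis
      by (simp add: pow_cv cv_eq_0)
  qed
  then obtain k where k: "((*v) A ^^ k x) x = 0" for x
    by metis
  \<comment> \<open>Once an iterate vanishes all later ones do, so the largest exponent over the
    basis works for every basis vector.\<close>
  define K where "K = Max (range (\<lambda>j::'n. k (axis j 1)))"
  have zero: "((*v) A ^^ m) 0 = 0" for m
    by (induction m) simp_all
  have K: "((*v) A ^^ K) (axis j 1) = 0" for j
  proof -
    have "k (axis j 1) \<le> K"
      by (simp add: K_def)
    then have "K = (K - k (axis j 1)) + k (axis j 1)"
      by simp
    then show ?thesis
      using k[of "axis j 1"] zero by (metis comp_apply funpow_add)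
  qed
  \<comment> \<open>Matrix powers act as iterates, so the columns of the \<open>K\<close>-th power
    are the vanishing images of the basis vectors.\<close>
  have "(((**) A ^^ m) (mat 1)) *v x = ((*v) A ^^ m) x" for m x
    by (induction m) (simp_all flip: matrix_vector_mul_assoc)
  with K have "column j (((**) A ^^ K) (mat 1)) = 0" for j
    by (simp flip: matrix_vector_mult_basis)
  then have "((**) A ^^ K) (mat 1) = 0"
    by (simp add: vec_eq_iff column_def)
  then show ?thesis
    by (auto simp: nilpotent_matrix_def)
qed

section \<open>The spectrum and comparison with its maxima\<close>

lemma eigenvalues_mset_nonempty: "eigenvalues_mset A \<noteq> {#}"
  using size_eigenvalues_mset[of A] by force

theorem corollary1p2:
  fixes A :: "real ^ 'n ^ 'n"
  shows
    "((\<forall>i j. 0 \<le> A $ i $ j) \<longrightarrow>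
        upper_quasi_eigenvalue A \<ge> ereal (Max (cmod ` set_mset (eigenvalues_mset A))) \<and>
        (\<not> nilpotent_matrix A \<longrightarrow> Max (cmod ` set_mset (eigenvalues_mset A)) > 0) \<and>
        ((\<exists>r. upper_quasi_eigenvalue A = ereal r \<and> is_eigenvalue A (complex_of_real r)) \<longrightarrow>
          upper_quasi_eigenvalue A = ereal (Max (cmod ` set_mset (eigenvalues_mset A))) \<and>
          (\<not> nilpotent_matrix A \<longrightarrow> Max (cmod ` set_mset (eigenvalues_mset A)) > 0)))
     \<and>
     ((\<forall>i j. i \<noteq> j \<longrightarrow> 0 \<le> A $ i $ j) \<longrightarrow>
        upper_quasi_eigenvalue A \<ge> ereal (Max (Re ` set_mset (eigenvalues_mset A))) \<and>
        ((\<exists>z. is_eigenvalue A z \<and> upper_quasi_eigenvalue A = ereal (Re z)) \<longrightarrow>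
          upper_quasi_eigenvalue A = ereal (Max (Re ` set_mset (eigenvalues_mset A)))))"
proof -
  define E where "E = set_mset (eigenvalues_mset A)"
  have E: "finite E" "E \<noteq> {}" "z \<in> E \<longleftrightarrow> is_eigenvalue A z" for z
    by (simp_all add: E_def eigenvalues_mset_nonempty) (simp add: set_eigenvalues_mset)
  have cmod_le: "cmod z \<le> Max (cmod ` E)" and Re_le: "Re z \<le> Max (Re ` E)" if "z \<in> E" for z
    using E that by auto
  \<comment> \<open>Both maxima are attained, so the bounds for single eigenvalues apply to
    them.\<close>
  have "Max (cmod ` E) \<in> cmod ` E" "Max (Re ` E) \<in> Re ` E"
    using E by (simp_all add: Max_in)
  then obtain z1 z2 where "z1 \<in> E" "Max (cmod ` E) = cmod z1" "z2 \<in> E" "Max (Re ` E) = Re z2"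
    by (elim imageE)
  then have z1: "is_eigenvalue A z1" "Max (cmod ` E) = cmod z1"
    and z2: "is_eigenvalue A z2" "Max (Re ` E) = Re z2"
    by (simp_all add: E(3))
  have pos: "Max (cmod ` E) > 0" if not_nilpotent: "\<not> nilpotent_matrix A"
  proof -
    obtain z where "is_eigenvalue A z" "z \<noteq> 0"
      using nilpotent_matrixI not_nilpotent by blast
    then have "0 < cmod z" "z \<in> E"
      by (simp_all add: E(3))
    with cmod_le[of z] show ?thesis
      by linarith
  qed
  have ge_cmod: "ereal (Max (cmod ` E)) \<le> upper_quasi_eigenvalue A" if "\<forall>i j. 0 \<le> A $ i $ j"
    using upper_quasi_eigenvalue_ge_cmod[of A z1] z1 that by simp
  have ge_Re: "ereal (Max (Re ` E)) \<le> upper_quasi_eigenvalue A"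
    if "\<forall>i j. i \<noteq> j \<longrightarrow> 0 \<le> A $ i $ j"
    using upper_quasi_eigenvalue_ge_Re[of A z2] z2 that by simp
  \<comment> \<open>The reverse inequality for a real eigenvalue: r \<le> |r|, and |r| is among the
    moduli.\<close>
  have le_cmod: "ereal r \<le> ereal (Max (cmod ` E))" if "is_eigenvalue A (complex_of_real r)" for r
    using cmod_le[of "complex_of_real r"] that E by simp
  have le_Re: "ereal (Re z) \<le> ereal (Max (Re ` E))" if "is_eigenvalue A z" for z
    using Re_le[of z] that E by simp
  show ?thesis
    unfolding E_def[symmetric]
  proof (intro conjI impI; (elim exE conjE)?)
    fix r
    assume "\<forall>i j. 0 \<le> A $ i $ j" "upper_quasi_eigenvalue A = ereal r"
      "is_eigenvalue A (complex_of_real r)"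
    then show "upper_quasi_eigenvalue A = ereal (Max (cmod ` E))"
      using ge_cmod le_cmod[of r] by (simp add: order_antisym)
  next
    fix z
    assume "\<forall>i j. i \<noteq> j \<longrightarrow> 0 \<le> A $ i $ j" "is_eigenvalue A z"
      "upper_quasi_eigenvalue A = ereal (Re z)"
    then show "upper_quasi_eigenvalue A = ereal (Max (Re ` E))"
      using ge_Re le_Re[of z] by (simp add: order_antisym)
  qed (rule pos ge_cmod ge_Re; assumption)+
qed

end
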